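(* Let $n\ge 1$ and let $\mathbf{m}=(m_1,\dots,m_n)$, $\mathbf{r}=(r_1,\dots,r_n)$ be vectors of positive integers, $m=m_1+\cdots+m_n$. Then, as formal power series in the variables $z_1,\dots,z_n,z_{m+1}$, $$\sum_{\pi^{\mathbf{c}}\in\mathfrak{S}_{\mathbf{m}}^{\mathbf{r}}}\frac{z_{\pi_1}^{c_1-1}\cdots z_{\pi_m}^{c_m-1}\prod_{\substack{i\in\{2,\dots,m+1\}\\ i-1\in\mathrm{DES}(\pi^{\mathbf{c}})}}z_{\pi_i}^{r_{\pi_i}}\cdots z_{\pi_m}^{r_{\pi_m}}z_{m+1}}{\prod_{i=1}^{m+1}\bigl(1-z_{\pi_i}^{r_{\pi_i}}\cdots z_{\pi_m}^{r_{\pi_m}}z_{m+1}\bigr)}=\sum_{t\ge 0}z_{m+1}^t\prod_{k=1}^n\begin{bmatrix}r_kt+m_k\\ m_k\end{bmatrix}_{z_k}.$$ For $i=m+1$ the expression $z_{\pi_i}^{r_{\pi_i}}\cdots z_{\pi_m}^{r_{\pi_m}}z_{m+1}$ is just $z_{m+1}$.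
   Context: $\mathfrak{S}_{\mathbf{m}}^{\mathbf{r}}$ denotes the set of colored multiset permutations: words $\pi^{\mathbf{c}}=\pi_1^{c_1}\pi_2^{c_2}\cdots\pi_m^{c_m}$ in which each $k\in\{1,\dots,n\}$ appears exactly $m_k$ times among $\pi_1,\dots,\pi_m$, and each color $c_j$ is an integer with $1\le c_j\le r_{\pi_j}$. One always appends $\pi_{m+1}^{c_{m+1}}:=(n+1)^1$. Colored letters are totally ordered by the color ordering: $k^{c}<l^{c'}$ iff $c<c'$, or $c=c'$ and $k<l$. An index $j\in\{1,\dots,m\}$ is a descent of $\pi^{\mathbf{c}}$ if $\pi_j^{c_j}>\pi_{j+1}^{c_{j+1}}$; $\mathrm{DES}(\pi^{\mathbf{c}})$ is the set of descents. $\begin{bmatrix}N\\ M\end{bmatrix}_q$ is the Gaussian ($q$-)binomial coefficient $\prod_{i=1}^{M}\frac{1-q^{N-M+i}}{1-q^i}$. *)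

theory Defs
  imports "HOL-Library.Poly_Mapping"
begin

section \<open>Formal power series in several variables\<close>

text \<open>
  The variables are indexed by the natural numbers; a monomial is a finitely supported
  exponent vector, and a power series is an arbitrary family of coefficients.
\<close>

typedef 'a mfps = "UNIV :: ((nat \<Rightarrow>\<^sub>0 nat) \<Rightarrow> 'a) set"
  morphisms mcoeff Abs_mfps
  by simp

lemma mcoeff_Abs [simp]: "mcoeff (Abs_mfps f) = f"
  by (simp add: Abs_mfps_inverse)

lemma mfps_eqI: "(\<And>a. mcoeff f a = mcoeff g a) \<Longrightarrow> f = g"
  by (metis ext mcoeff_inject)

definition splits :: "(nat \<Rightarrow>\<^sub>0 nat) \<Rightarrow> ((nat \<Rightarrow>\<^sub>0 nat) \<times> (nat \<Rightarrow>\<^sub>0 nat)) set" where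
  "splits a = {(b, c). b + c = a}"

lemma finite_splits [simp]: "finite (splits a)"
proof -
  let ?M = "Max (insert 0 (Poly_Mapping.lookup a ` Poly_Mapping.keys a))"
  let ?F = "{f. \<forall>x. (x \<in> Poly_Mapping.keys a \<longrightarrow> f x \<in> {..?M}) \<and> (x \<notin> Poly_Mapping.keys a \<longrightarrow> f x = 0)}"
  have below: "Poly_Mapping.lookup b \<in> ?F" if "b + c = a" for b c
  proof -
    have le: "Poly_Mapping.lookup b x \<le> Poly_Mapping.lookup a x" for x
      using that by (auto simp: Poly_Mapping.lookup_add)
    have "Poly_Mapping.lookup a x \<le> ?M" for x
      by (cases "x \<in> Poly_Mapping.keys a") (auto simp: in_keys_iff)
    with le have "Poly_Mapping.lookup b x \<le> ?M" for x using order_trans by blast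
    moreover have "Poly_Mapping.lookup b x = 0" if "x \<notin> Poly_Mapping.keys a" for x
      using le[of x] that by (simp add: in_keys_iff)
    ultimately show ?thesis by auto
  qed
  have "finite ?F" by (rule finite_set_of_finite_funs) auto
  then have "finite {b. Poly_Mapping.lookup b \<in> ?F}"
    using finite_vimageI[of ?F Poly_Mapping.lookup] by (simp add: vimage_def inj_on_def lookup_inject)
  then have "finite ({b. Poly_Mapping.lookup b \<in> ?F} \<times> {c. Poly_Mapping.lookup c \<in> ?F})" by simp
  moreover have "splits a \<subseteq> {b. Poly_Mapping.lookup b \<in> ?F} \<times> {c. Poly_Mapping.lookup c \<in> ?F}"
  proof (rule subrelI)
    fix b c assume "(b, c) \<in> splits a"
    then have "b + c = a" by (simp add: splits_def)
    then show "(b, c) \<in> {b. Poly_Mapping.lookup b \<in> ?F} \<times> {c. Poly_Mapping.lookup c \<in> ?F}"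
      using below[of b c] below[of c b] by (simp add: add.commute)
  qed
  ultimately show ?thesis by (rule rev_finite_subset)
qed

instantiation mfps :: (comm_ring_1) comm_ring_1
begin

definition "0 = Abs_mfps (\<lambda>_. 0)"
definition "1 = Abs_mfps (\<lambda>a. if a = 0 then 1 else 0)"
definition "f + g = Abs_mfps (\<lambda>a. mcoeff f a + mcoeff g a)"
definition "f - g = Abs_mfps (\<lambda>a. mcoeff f a - mcoeff g a)"
definition "- f = Abs_mfps (\<lambda>a. - mcoeff f a)"
definition "f * g = Abs_mfps (\<lambda>a. \<Sum>(b, c)\<in>splits a. mcoeff f b * mcoeff g c)"

lemma mcoeff_simps [simp]:
  "mcoeff 0 a = 0"
  "mcoeff 1 a = (if a = 0 then 1 else 0)"
  "mcoeff (f + g) a = mcoeff f a + mcoeff g a"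
  "mcoeff (f - g) a = mcoeff f a - mcoeff g a"
  "mcoeff (- f) a = - mcoeff f a"
  by (simp_all add: zero_mfps_def one_mfps_def plus_mfps_def minus_mfps_def uminus_mfps_def)

lemma mcoeff_mult: "mcoeff (f * g) a = (\<Sum>(b, c)\<in>splits a. mcoeff f b * mcoeff g c)"
  by (simp add: times_mfps_def)

instance
proof
  fix f g h :: "'a mfps"
  show "f * g = g * f"
  proof (rule mfps_eqI)
    fix a
    show "mcoeff (f * g) a = mcoeff (g * f) a"
      unfolding mcoeff_mult
      by (rule sum.reindex_bij_witness[of _ prod.swap prod.swap])
         (auto simp: splits_def add.commute mult.commute)
  qed
  show "f * g * h = f * (g * h)"
  proof (rule mfps_eqI)
    fix a
    have "mcoeff (f * g * h) a =
        (\<Sum>((d, c), (b, e))\<in>Sigma (splits a) (\<lambda>(d, c). splits d). mcoeff f b * mcoeff g e * mcoeff h c)"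
      by (subst sum.Sigma[symmetric])
         (auto simp: mcoeff_mult sum_distrib_right intro!: sum.cong)
    also have "\<dots> =
        (\<Sum>((b, d), (e, c))\<in>Sigma (splits a) (\<lambda>(b, d). splits d). mcoeff f b * mcoeff g e * mcoeff h c)"
      by (rule sum.reindex_bij_witness[of _
            "\<lambda>((b, d), (e, c)). ((b + e, c), (b, e))" "\<lambda>((d, c), (b, e)). ((b, e + c), (e, c))"])
         (auto simp: splits_def add.assoc)
    also have "\<dots> = mcoeff (f * (g * h)) a"
      by (subst sum.Sigma[symmetric])
         (auto simp: mcoeff_mult sum_distrib_left mult.assoc intro!: sum.cong)
    finally show "mcoeff (f * g * h) a = mcoeff (f * (g * h)) a" .
  qed
  show "1 * f = f"
  proof (rule mfps_eqI)
    fix a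
    have "mcoeff (1 * f) a = (\<Sum>p\<in>splits a. if p = (0, a) then mcoeff f a else 0)"
      unfolding mcoeff_mult by (rule sum.cong) (auto simp: splits_def split: if_splits)
    then show "mcoeff (1 * f) a = mcoeff f a"
      by (simp add: sum.delta) (simp add: splits_def)
  qed
  show "(f + g) * h = f * h + g * h"
    by (rule mfps_eqI)
       (simp add: mcoeff_mult distrib_right case_prod_beta sum.distrib)
  show "(0 :: 'a mfps) \<noteq> 1"
    by (metis mcoeff_simps(1,2) zero_neq_one)
qed (rule mfps_eqI, simp)+

end

definition mvar :: "nat \<Rightarrow> 'a::comm_ring_1 mfps" where
  "mvar i = Abs_mfps (\<lambda>a. if a = Poly_Mapping.single i 1 then 1 else 0)"

text \<open>
  Division is multiplication by the (unique) multiplicative inverse; non-units get the dummy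
  inverse \<open>0\<close>.
\<close>

instantiation mfps :: (comm_ring_1) inverse
begin

definition inverse_mfps_def:
  "inverse (f :: 'a mfps) = (if f dvd 1 then (THE g. f * g = 1) else 0)"

definition divide_mfps_def:
  "(f :: 'a mfps) div g = f * inverse g"

instance ..

end

lemma mfps_inverse_eqI:
  fixes f g :: "'a::comm_ring_1 mfps"
  assumes "f * g = 1"
  shows "inverse f = g"
proof -
  have "h = g" if "f * h = 1" for h
    using assms that by (metis mult.assoc mult.commute mult_1)
  with assms have "(THE h. f * h = 1) = g" by blast
  then show ?thesis using assms unfolding inverse_mfps_def by (metis dvd_triv_left)
qed

definition tdeg :: "(nat \<Rightarrow>\<^sub>0 nat) \<Rightarrow> nat" where
  "tdeg a = Sum_any (Poly_Mapping.lookup a)"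

lemma tdeg_add: "tdeg (a + b) = tdeg a + tdeg b"
  unfolding tdeg_def Poly_Mapping.lookup_add by (rule Sum_any.distrib) simp_all

lemma tdeg_pos: "a \<noteq> 0 \<Longrightarrow> 0 < tdeg a"
proof -
  assume "a \<noteq> 0"
  then obtain x where x: "x \<in> Poly_Mapping.keys a" by (metis all_not_in_conv keys_eq_empty)
  then have "0 < (\<Sum>x\<in>Poly_Mapping.keys a. Poly_Mapping.lookup a x)"
    by (intro sum_pos2[of _ x]) (auto simp: in_keys_iff)
  then show ?thesis
    unfolding tdeg_def by (simp add: Sum_any.expand_set keys.rep_eq)
qed

lemma mcoeff_power_eq_0:
  fixes h :: "'a::comm_ring_1 mfps"
  assumes "mcoeff h 0 = 0" and "tdeg a < k"
  shows "mcoeff (h ^ k) a = 0"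
  using assms(2)
proof (induction k arbitrary: a)
  case (Suc k)
  have "mcoeff h b * mcoeff (h ^ k) c = 0" if "b + c = a" for b c
  proof (cases "b = 0")
    case False
    then have "tdeg c < k" using tdeg_pos[of b] tdeg_add[of b c] that Suc.prems by simp
    then show ?thesis by (simp add: Suc.IH)
  qed (simp add: assms)
  then show ?case by (auto simp: mcoeff_mult splits_def intro!: sum.neutral)
qed simp

lemma mfps_mult_inverse:
  fixes f :: "'a::comm_ring_1 mfps"
  assumes "mcoeff f 0 = 1"
  shows "f * inverse f = 1"
proof -
  define h where "h = 1 - f"
  define g where "g = Abs_mfps (\<lambda>a. mcoeff (\<Sum>i<Suc (tdeg a). h ^ i) a)"
  have h0: "mcoeff h 0 = 0" using assms by (simp add: h_def)
  have g: "mcoeff g a = mcoeff (\<Sum>i<Suc N. h ^ i) a" if "tdeg a \<le> N" for a N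
    using that
  proof (induction N rule: dec_induct)
    case base
    show ?case by (simp add: g_def)
  next
    case (step N)
    then show ?case using mcoeff_power_eq_0[OF h0, of a "Suc N"] by simp
  qed
  have "f * g = 1"
  proof (rule mfps_eqI)
    fix a
    have "mcoeff (f * g) a = mcoeff (f * (\<Sum>i<Suc (tdeg a). h ^ i)) a"
      unfolding mcoeff_mult
    proof (rule sum.cong, goal_cases)
      case (2 p)
      then have "tdeg (snd p) \<le> tdeg a" by (auto simp: splits_def tdeg_add)
      then show ?case using g[of "snd p" "tdeg a"] by (simp add: case_prod_beta)
    qed simp
    also have "f * (\<Sum>i<Suc (tdeg a). h ^ i) = 1 - h ^ Suc (tdeg a)"
      by (simp only: one_diff_power_eq) (simp add: h_def)
    also have "mcoeff \<dots> a = mcoeff 1 a"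
      by (simp add: mcoeff_power_eq_0[OF h0] del: power_Suc)
    finally show "mcoeff (f * g) a = mcoeff 1 a" .
  qed
  then show ?thesis using mfps_inverse_eqI by metis
qed

text \<open>
  Convergence of an infinite sum of power series: every monomial occurs in only finitely many
  summands, and coefficients are added monomial by monomial.
\<close>

definition mfps_sums :: "(nat \<Rightarrow> 'a::comm_ring_1 mfps) \<Rightarrow> 'a mfps \<Rightarrow> bool" (infix "mfps'_sums" 50) where
  "F mfps_sums S \<longleftrightarrow>
     (\<forall>a. finite {t. mcoeff (F t) a \<noteq> 0} \<and>
          mcoeff S a = (\<Sum>t | mcoeff (F t) a \<noteq> 0. mcoeff (F t) a))"


section \<open>Gaussian binomial coefficients\<close>

text \<open>Only meaningful for \<open>M \<le> N\<close>, because of the truncated subtraction.\<close>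

definition qbinom :: "nat \<Rightarrow> nat \<Rightarrow> 'a::comm_ring_1 mfps \<Rightarrow> 'a mfps" where
  "qbinom N M q = (\<Prod>i = 1..M. (1 - q ^ (N - M + i)) / (1 - q ^ i))"


section \<open>Colored multiset permutations\<close>

text \<open>
  A colored letter \<open>k\<^sup>c\<close> is the pair \<open>(k, c)\<close>.  The vectors \<open>(m\<^sub>1, \<dots>, m\<^sub>n)\<close> and
  \<open>(r\<^sub>1, \<dots>, r\<^sub>n)\<close> are functions of which only the values on \<open>{1..n}\<close> are used.
\<close>

type_synonym cletter = "nat \<times> nat"

definition colored_perms :: "nat \<Rightarrow> (nat \<Rightarrow> nat) \<Rightarrow> (nat \<Rightarrow> nat) \<Rightarrow> cletter list set" where
  "colored_perms n mult r =
     {w. set (map fst w) \<subseteq> {1..n} \<and>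
         (\<forall>k\<in>{1..n}. count_list (map fst w) k = mult k) \<and>
         (\<forall>(k, c)\<in>set w. 1 \<le> c \<and> c \<le> r k)}"

lemma finite_colored_perms: "finite (colored_perms n mult r)"
proof (rule finite_subset)
  let ?A = "Sigma {1..n} (\<lambda>k. {1..r k})"
  show "colored_perms n mult r \<subseteq> {w. set w \<subseteq> ?A \<and> length w = (\<Sum>k = 1..n. mult k)}"
  proof
    fix w assume w: "w \<in> colored_perms n mult r"
    then have sub: "set (map fst w) \<subseteq> {1..n}" by (simp add: colored_perms_def)
    have "length w = (\<Sum>k\<in>set (map fst w). count_list (map fst w) k)"
      by (simp only: sum_count_set[OF subset_refl finite_set] length_map)
    also have "\<dots> = (\<Sum>k = 1..n. count_list (map fst w) k)"
      using sub by (intro sum.mono_neutral_left) (auto simp: count_list_0_iff)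
    also have "\<dots> = (\<Sum>k = 1..n. mult k)"
      using w by (intro sum.cong) (auto simp: colored_perms_def)
    finally show "w \<in> {w. set w \<subseteq> ?A \<and> length w = (\<Sum>k = 1..n. mult k)}"
      using w by (fastforce simp: colored_perms_def)
  qed
  show "finite {w. set w \<subseteq> ?A \<and> length w = (\<Sum>k = 1..n. mult k)}"
    by (intro finite_lists_length_eq) simp
qed

definition color_less :: "cletter \<Rightarrow> cletter \<Rightarrow> bool" where
  "color_less x y \<longleftrightarrow> snd x < snd y \<or> snd x = snd y \<and> fst x < fst y"

text \<open>Positions in a word are counted from 1.\<close>

definition letter_at :: "cletter list \<Rightarrow> nat \<Rightarrow> nat" where
  "letter_at w j = fst (w ! (j - 1))"

definition color_at :: "cletter list \<Rightarrow> nat \<Rightarrow> nat" where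
  "color_at w j = snd (w ! (j - 1))"

text \<open>The word is extended by the letter \<open>(n + 1)\<^sup>1\<close>, so its last position can be a descent.\<close>

definition DES :: "nat \<Rightarrow> cletter list \<Rightarrow> nat set" where
  "DES n w = {j \<in> {1..length w}.
     color_less ((w @ [(n + 1, 1)]) ! j) ((w @ [(n + 1, 1)]) ! (j - 1))}"

text \<open>
  The monomial \<open>z\<^bsub>\<pi>\<^sub>i\<^esub>\<^sup>r \<cdots> z\<^bsub>\<pi>\<^sub>m\<^esub>\<^sup>r z\<^bsub>m+1\<^esub>\<close>, each exponent \<open>r\<close> being indexed by the respective
  letter, where \<open>m\<close> is the length of the word; it is \<open>z\<^bsub>m+1\<^esub>\<close> for \<open>i = m + 1\<close>.
\<close>

definition tail_monom :: "(nat \<Rightarrow> nat) \<Rightarrow> cletter list \<Rightarrow> nat \<Rightarrow> 'a::comm_ring_1 mfps" where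
  "tail_monom r w i =
     (\<Prod>j = i..length w. mvar (letter_at w j) ^ r (letter_at w j)) * mvar (length w + 1)"

end

theory Submission
  imports Defs "HOL-Library.Multiset" "HOL-Library.Product_Lexorder" "HOL-Library.FuncSet"
begin

text \<open>
  Expanding the geometric series for a word \<open>w\<close> turns the exponent of the \<open>i\<close>-th tail monomial
  into the increment \<open>s\<^sub>i - s\<^sub>i\<^sub>-\<^sub>1\<close> of a sequence \<open>0 \<le> s\<^sub>1 \<le> \<dots> \<le> s\<^sub>m \<le> t\<close> of heights that increases
  strictly at the descents of \<open>w\<close>.  Such a pair of a word and a sequence is the same as a
  lexicographically sorted list of triples (height, color, letter), all below \<open>(t, 1, n + 1)\<close>, the
  appended letter at height \<open>t\<close>.  A sorted list is a multiset, and since division by \<open>r\<^sub>k\<close> writes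
  every number in \<open>{0..r\<^sub>k t}\<close> uniquely as \<open>r\<^sub>k s + (c - 1)\<close>, it amounts to a choice, for each letter
  \<open>k\<close>, of a multiset of \<open>m\<^sub>k\<close> numbers in \<open>{0..r\<^sub>k t}\<close>; these are counted by the Gaussian binomial
  coefficients.
\<close>

section \<open>Truncation of power series\<close>

lemma tdeg_0 [simp]: "tdeg 0 = 0"
  by (simp add: tdeg_def)

lemma tdeg_eq_0_iff [simp]: "tdeg a = 0 \<longleftrightarrow> a = 0"
  using tdeg_pos[of a] by (cases "a = 0") auto

lemma mcoeff_sum: "mcoeff (sum f A) a = (\<Sum>x\<in>A. mcoeff (f x) a)"
  by (induction A rule: infinite_finite_induct) auto

lemma splits_0: "splits 0 = {(0, 0)}"
proof -
  have "b + c = 0 \<longleftrightarrow> b = 0 \<and> c = 0" for b c :: "nat \<Rightarrow>\<^sub>0 nat"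
    by (metis add_is_0 add_0 tdeg_add tdeg_eq_0_iff)
  then show ?thesis by (auto simp: splits_def)
qed

lemma mcoeff_mult_0 [simp]: "mcoeff (f * g) 0 = mcoeff f 0 * mcoeff g 0"
  by (simp add: mcoeff_mult splits_0)

lemma mcoeff_prod_0: "mcoeff (prod f A) 0 = (\<Prod>x\<in>A. mcoeff (f x) 0)"
  by (induction A rule: infinite_finite_induct) auto

lemma mcoeff_power_0: "mcoeff (f ^ k) 0 = mcoeff f 0 ^ k"
  by (induction k) auto

lemma mcoeff_mvar_0 [simp]: "mcoeff (mvar i) 0 = 0"
proof -
  have "Poly_Mapping.single i 1 \<noteq> (0 :: nat \<Rightarrow>\<^sub>0 nat)"
    by (metis lookup_single_eq lookup_zero zero_neq_one)
  then show ?thesis by (auto simp: mvar_def)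
qed

text \<open>Membership in the ideal of series without terms of total degree at most
  \<open>N\<close>.\<close>

definition vanishes_upto :: "nat \<Rightarrow> 'a::comm_ring_1 mfps \<Rightarrow> bool" where
  "vanishes_upto N f \<longleftrightarrow> (\<forall>a. tdeg a \<le> N \<longrightarrow> mcoeff f a = 0)"

lemma vanishes_upto_add: "vanishes_upto N f \<Longrightarrow> vanishes_upto N g \<Longrightarrow> vanishes_upto N (f + g)"
  by (simp add: vanishes_upto_def)

lemma vanishes_upto_sum: "(\<And>x. x \<in> A \<Longrightarrow> vanishes_upto N (f x)) \<Longrightarrow> vanishes_upto N (sum f A)"
  by (simp add: vanishes_upto_def mcoeff_sum)

lemma vanishes_upto_mult: "vanishes_upto N f \<Longrightarrow> vanishes_upto N (f * g)"
  by (auto simp: vanishes_upto_def mcoeff_mult splits_def tdeg_add intro!: sum.neutral)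

lemma vanishes_upto_power: "mcoeff q 0 = 0 \<Longrightarrow> vanishes_upto N (q ^ Suc N)"
  unfolding vanishes_upto_def by (intro allI impI mcoeff_power_eq_0 le_imp_less_Suc)

text \<open>As \<open>q\<close> has no constant term, \<open>q ^ t\<close> has no terms of degree
  below \<open>t\<close>, so the partial sum up to \<open>N\<close> fixes all coefficients of degree
  at most \<open>N\<close>. Convergence becomes a family of congruences.\<close>

lemma mfps_sums_iff:
  fixes q S :: "'a::comm_ring_1 mfps"
  assumes "mcoeff q 0 = 0"
  shows "(\<lambda>t. q ^ t * g t) mfps_sums S \<longleftrightarrow> (\<forall>N. vanishes_upto N (S - (\<Sum>t\<le>N. q ^ t * g t)))"
proof -
  let ?F = "\<lambda>t. q ^ t * g t"
  have zero: "mcoeff (?F t) a = 0" if lt: "tdeg a < t" for t a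
  proof -
    obtain N where t: "t = Suc N" using lt by (cases t) auto
    have "vanishes_upto N (?F t)"
      unfolding t by (intro vanishes_upto_mult vanishes_upto_power assms)
    moreover have "tdeg a \<le> N" using lt t by linarith
    ultimately show ?thesis unfolding vanishes_upto_def by blast
  qed
  have sub: "{t. mcoeff (?F t) a \<noteq> 0} \<subseteq> {..tdeg a}" for a
  proof
    fix t assume "t \<in> {t. mcoeff (?F t) a \<noteq> 0}"
    then have "\<not> tdeg a < t" using zero[of a t] by blast
    then show "t \<in> {..tdeg a}" by simp
  qed
  have fin: "finite {t. mcoeff (?F t) a \<noteq> 0}" for a
    by (rule finite_subset[OF sub]) simp
  have eq: "(\<Sum>t | mcoeff (?F t) a \<noteq> 0. mcoeff (?F t) a) = mcoeff (\<Sum>t\<le>N. ?F t) a" if "tdeg a \<le> N" for a N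
    unfolding mcoeff_sum
  proof (rule sum.mono_neutral_left)
    show "{t. mcoeff (?F t) a \<noteq> 0} \<subseteq> {..N}"
      using sub[of a] that by (meson atMost_subset_iff order_trans)
  qed blast+
  show ?thesis
  proof
    assume S: "?F mfps_sums S"
    show "\<forall>N. vanishes_upto N (S - (\<Sum>t\<le>N. ?F t))"
      unfolding vanishes_upto_def
    proof (intro allI impI)
      fix N a assume "tdeg a \<le> N"
      from eq[OF this] S show "mcoeff (S - (\<Sum>t\<le>N. ?F t)) a = 0"
        unfolding mfps_sums_def by (metis mcoeff_simps(4) diff_self)
    qed
  next
    assume *: "\<forall>N. vanishes_upto N (S - (\<Sum>t\<le>N. ?F t))"
    have "mcoeff S a = mcoeff (\<Sum>t\<le>tdeg a. ?F t) a" for a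
    proof -
      have "mcoeff (S - (\<Sum>t\<le>tdeg a. ?F t)) a = 0"
        using * unfolding vanishes_upto_def by blast
      then show ?thesis unfolding mcoeff_simps by (rule eq_iff_diff_eq_0[THEN iffD2])
    qed
    then show "?F mfps_sums S"
      unfolding mfps_sums_def eq[OF order_refl] using fin by blast
  qed
qed

lemma mfps_sums_sum:
  fixes F :: "'b \<Rightarrow> nat \<Rightarrow> 'a::comm_ring_1 mfps"
  assumes "mcoeff q 0 = 0" "\<And>w. w \<in> W \<Longrightarrow> (\<lambda>t. q ^ t * F w t) mfps_sums S w"
  shows "(\<lambda>t. q ^ t * (\<Sum>w\<in>W. c w * F w t)) mfps_sums (\<Sum>w\<in>W. c w * S w)"
  unfolding mfps_sums_iff[OF assms(1)]
proof
  fix N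
  have "(\<Sum>w\<in>W. c w * S w) - (\<Sum>t\<le>N. q ^ t * (\<Sum>w\<in>W. c w * F w t)) =
      (\<Sum>w\<in>W. (S w - (\<Sum>t\<le>N. q ^ t * F w t)) * c w)"
  proof -
    have "(\<Sum>t\<le>N. q ^ t * (\<Sum>w\<in>W. c w * F w t)) = (\<Sum>w\<in>W. (\<Sum>t\<le>N. q ^ t * F w t) * c w)"
      unfolding sum_distrib_left sum_distrib_right
      by (subst sum.swap) (simp add: mult_ac)
    then show ?thesis by (simp add: sum_subtractf right_diff_distrib mult.commute[of _ "c _"])
  qed
  then show "vanishes_upto N ((\<Sum>w\<in>W. c w * S w) - (\<Sum>t\<le>N. q ^ t * (\<Sum>w\<in>W. c w * F w t)))"
    using assms(2) unfolding mfps_sums_iff[OF assms(1)]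
    by (simp only:) (intro vanishes_upto_sum vanishes_upto_mult, blast)
qed

section \<open>Quotients and sums of coefficients\<close>

lemma inverse_mfps_prod:
  fixes f :: "'b \<Rightarrow> 'a::comm_ring_1 mfps"
  assumes "\<And>x. x \<in> A \<Longrightarrow> mcoeff (f x) 0 = 1"
  shows "inverse (prod f A) = (\<Prod>x\<in>A. inverse (f x))"
proof (rule mfps_inverse_eqI)
  have "prod f A * (\<Prod>x\<in>A. inverse (f x)) = (\<Prod>x\<in>A. f x * inverse (f x))"
    by (rule prod.distrib[symmetric])
  also have "\<dots> = 1"
    using assms by (intro prod.neutral ballI mfps_mult_inverse)
  finally show "prod f A * (\<Prod>x\<in>A. inverse (f x)) = 1" .
qed

lemma mfps_divide_eqI:
  fixes f :: "'a::comm_ring_1 mfps"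
  assumes "mcoeff g 0 = 1" "h * g = f"
  shows "f / g = h"
  unfolding divide_mfps_def assms(2)[symmetric]
  by (simp add: mult.assoc mfps_mult_inverse assms(1))

text \<open>Division by \<open>1 - q\<close> sums the \<open>f u\<close> over
  \<open>u \<le> t\<close>; an extra factor \<open>q\<close> shifts the index and gives the sum over
  \<open>u < t\<close>. A finite identity with a remainder divisible by \<open>q ^ Suc N\<close>
  replaces any rearrangement of infinite sums.\<close>

lemma mfps_sums_partial_sums:
  fixes q S :: "'a::comm_ring_1 mfps"
  assumes q: "mcoeff q 0 = 0" and S: "(\<lambda>t. q ^ t * f t) mfps_sums S"
  shows "(\<lambda>t. q ^ t * (\<Sum>u\<in>(if strict then {..<t} else {..t}). f u)) mfps_sums
    ((if strict then q else 1) * S) * inverse (1 - q)"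
proof -
  let ?e = "if strict then q else 1"
  define g where "g t = (\<Sum>u\<in>(if strict then {..<t} else {..t}). f u)" for t
  have tele: "(1 - q) * (\<Sum>t\<le>N. q ^ t * g t) =
      ?e * (\<Sum>t\<le>N. q ^ t * f t) - q ^ Suc N * (\<Sum>u\<le>N. f u)" for N
  proof (induction N)
    case (Suc N)
    have *: "(1 - q) * (q ^ Suc N * g (Suc N)) =
       ?e * (q ^ Suc N * f (Suc N)) - q ^ Suc (Suc N) * (\<Sum>u\<le>Suc N. f u) + q ^ Suc N * (\<Sum>u\<le>N. f u)"
      by (auto simp: g_def algebra_simps lessThan_Suc_atMost)
    show ?case
      unfolding sum.atMost_Suc[of "\<lambda>t. q ^ t * g t"] sum.atMost_Suc[of "\<lambda>t. q ^ t * f t"]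
        distrib_left Suc.IH * by simp
  qed (auto simp: g_def algebra_simps)
  have "vanishes_upto N (?e * S * inverse (1 - q) - (\<Sum>t\<le>N. q ^ t * g t))" for N
  proof -
    have inv: "(1 - q) * inverse (1 - q) = 1" using q by (simp add: mfps_mult_inverse)
    \<comment> \<open>The second equation is solved for \<open>Y\<close> by multiplying with
      \<open>I\<close>. Both terms of the result vanish up to \<open>N\<close>:
      \<open>S' - P\<close> is the tail of the given sum and \<open>Q\<close> is
      \<open>q ^ Suc N\<close>.\<close>
    have alg: "E * S' * I - Y = (S' - P) * (E * I) + Q * (F * I)"
      if "(1 - q) * I = 1" "(1 - q) * Y = E * P - Q * F" for E S' I Y P Q F :: "'a mfps"
    proof -
      have "Y = ((1 - q) * I) * Y" using that(1) by simp
      also have "\<dots> = ((1 - q) * Y) * I" by (simp only: ac_simps)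
      finally have "Y = (E * P - Q * F) * I" using that(2) by simp
      then show ?thesis by (simp add: algebra_simps)
    qed
    have "?e * S * inverse (1 - q) - (\<Sum>t\<le>N. q ^ t * g t) =
        (S - (\<Sum>t\<le>N. q ^ t * f t)) * (?e * inverse (1 - q))
         + q ^ Suc N * ((\<Sum>u\<le>N. f u) * inverse (1 - q))"
      by (rule alg[OF inv tele])
    moreover have "vanishes_upto N (S - (\<Sum>t\<le>N. q ^ t * f t))"
      using S unfolding mfps_sums_iff[OF q] by blast
    ultimately show ?thesis
      by (simp only:) (intro vanishes_upto_add vanishes_upto_mult vanishes_upto_power q)
  qed
  then show ?thesis unfolding g_def[symmetric] mfps_sums_iff[OF q] by blast
qed

section \<open>Words with weakly increasing heights\<close>

text \<open>A cell is a triple (height, color, letter), so that its lexicographic order refines the color order.\<close>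

type_synonym cell = "nat \<times> nat \<times> nat"

definition letter_of :: "cell \<Rightarrow> cletter" where
  "letter_of = (\<lambda>(s, c, k). (k, c))"

text \<open>At equal heights the colored letters are compared, so sortedness forces the height to
  rise strictly at every descent; \<open>e\<close> is the appended letter with its height.\<close>

definition cell_chains :: "cletter list \<Rightarrow> cell \<Rightarrow> cell list set" where
  "cell_chains w e = {L. map letter_of L = w \<and> sorted (L @ [e])}"

definition chain_sum :: "(cletter \<Rightarrow> 'a::comm_semiring_1) \<Rightarrow> cletter list \<Rightarrow> cell \<Rightarrow> 'a" where
  "chain_sum Z w e = (\<Sum>L\<in>cell_chains w e. \<Prod>x\<leftarrow>L. Z (letter_of x) ^ fst x)"

lemma cell_chains_Nil [simp]: "cell_chains [] e = {[]}"
  by (auto simp: cell_chains_def)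

lemma sorted_snoc_snoc: "sorted ((L @ [x]) @ [e]) \<longleftrightarrow> sorted (L @ [x]) \<and> x \<le> (e :: 'a::linorder)"
  by (auto simp: sorted_append intro: order_trans)

text \<open>By transitivity \<open>e\<close> constrains only the last cell, which in turn becomes
  the bound for the remaining ones.\<close>

lemma cell_chains_snoc:
  "cell_chains (w @ [(k, c)]) e = (\<Union>u\<in>{u. (u, c, k) \<le> e}. (\<lambda>L. L @ [(u, c, k)]) ` cell_chains w (u, c, k))"
proof -
  have "L \<in> cell_chains (w @ [(k, c)]) e \<longleftrightarrow>
      (\<exists>u L'. L = L' @ [(u, c, k)] \<and> (u, c, k) \<le> e \<and> L' \<in> cell_chains w (u, c, k))" for L
  proof (cases L rule: rev_cases)
    case (snoc L' x)
    obtain u c' k' where "x = (u, c', k')" by (cases x)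
    then show ?thesis
      unfolding snoc cell_chains_def mem_Collect_eq sorted_snoc_snoc
      by (auto simp: letter_of_def simp del: less_eq_prod_simp)
  qed (simp add: cell_chains_def)
  then show ?thesis by blast
qed

text \<open>The last letter may reach the height of the bound unless the step to the bound is a
  descent. Each strict inequality between heights comes from here.\<close>

lemma cells_below: "{u :: nat. (u, c, k) \<le> (t, c', k')} = (if color_less (k', c') (k, c) then {..<t} else {..t})"
  by (cases "c' < c"; cases "c = c'") (auto simp: color_less_def)

lemma finite_cells_below [simp]: "finite {u. (u, c, k) \<le> (e :: cell)}"
  by (cases e) (simp only: cells_below split: if_splits, simp)

lemma finite_cell_chains: "finite (cell_chains w e)"
proof (induction w arbitrary: e rule: rev_induct)
  case (snoc y w)
  then show ?case by (cases y) (simp add: cell_chains_snoc)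
qed simp

lemma chain_sum_snoc:
  "chain_sum Z (w @ [(k, c)]) e = (\<Sum>u | (u, c, k) \<le> e. chain_sum Z w (u, c, k) * Z (k, c) ^ u)"
  unfolding chain_sum_def cell_chains_snoc
proof (subst sum.UNION_disjoint, goal_cases)
  case 4
  have "sum h ((\<lambda>L. L @ [x]) ` X) = (\<Sum>L\<in>X. h (L @ [x]))" for h :: "cell list \<Rightarrow> 'a" and x X
    by (subst sum.reindex) (simp_all add: inj_on_def)
  then show ?case
    by (simp add: sum_distrib_right letter_of_def)
qed (auto simp: finite_cell_chains)

text \<open>\<open>DES\<close> with an arbitrary appended letter \<open>x\<close>, so that a letter
  removed from the end of the word can take the place of \<open>x\<close>.\<close>

definition descents :: "cletter list \<Rightarrow> cletter \<Rightarrow> nat set" where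
  "descents w x = {j \<in> {1..length w}. color_less ((w @ [x]) ! j) ((w @ [x]) ! (j - 1))}"

text \<open>\<open>tail_monom\<close> with a free \<open>q\<close> instead of the last variable,
  whose index there depends on the length of the word.\<close>

definition tail_prod :: "(cletter \<Rightarrow> 'a::comm_monoid_mult) \<Rightarrow> 'a \<Rightarrow> cletter list \<Rightarrow> nat \<Rightarrow> 'a" where
  "tail_prod Z q w i = (\<Prod>j = i..length w. Z (w ! (j - 1))) * q"

lemma tail_prod_last: "tail_prod Z q w (Suc (length w)) = q"
  by (simp add: tail_prod_def)

lemma tail_prod_snoc:
  assumes "1 \<le> i" "i \<le> Suc (length w)"
  shows "tail_prod Z q (w @ [y]) i = tail_prod Z (q * Z y) w i"
proof -
  have "(\<Prod>j = i..length w. Z ((w @ [y]) ! (j - 1))) = (\<Prod>j = i..length w. Z (w ! (j - 1)))"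
    using assms by (intro prod.cong) (auto simp: nth_append)
  then show ?thesis using assms by (simp add: tail_prod_def ac_simps)
qed

lemma descents_snoc:
  "descents (w @ [y]) x = descents w y \<union> (if color_less x y then {Suc (length w)} else {})"
  unfolding descents_def by (auto simp: nth_append le_Suc_eq)

lemma descents_subset: "descents w x \<subseteq> {1..length w}"
  by (auto simp: descents_def)

definition tail_numerator where
  "tail_numerator Z q w x = (\<Prod>i\<in>{i \<in> {2..length w + 1}. i - 1 \<in> descents w x}. tail_prod Z q w i)"

text \<open>A descent at the new last position contributes its own tail product, which is
  \<open>q\<close>; in the other factors the weight of \<open>y\<close> passes into
  \<open>q\<close>.\<close>

lemma tail_numerator_snoc:
  "tail_numerator Z q (w @ [y]) x =
    (if color_less x y then q else 1) * tail_numerator Z (q * Z y) w y"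
proof -
  let ?A = "{i \<in> {2..length w + 1}. i - 1 \<in> descents w y}"
  have "{i \<in> {2..length (w @ [y]) + 1}. i - 1 \<in> descents (w @ [y]) x} =
      (if color_less x y then insert (Suc (Suc (length w))) ?A else ?A)"
    using descents_subset[of w y] by (fastforce simp: descents_snoc split: if_splits)
  moreover have "(\<Prod>i\<in>?A. tail_prod Z q (w @ [y]) i) = tail_numerator Z (q * Z y) w y"
    unfolding tail_numerator_def by (intro prod.cong) (auto simp: tail_prod_snoc)
  moreover have "tail_prod Z q (w @ [y]) (Suc (Suc (length w))) = q"
    using tail_prod_last[of Z q "w @ [y]"] by simp
  ultimately show ?thesis
    by (simp add: tail_numerator_def[of Z q "w @ [y]"])
qed

text \<open>
  The statement is inductive only because \<open>q\<close> is arbitrary: removing the last letter \<open>y\<close> of the word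
  replaces \<open>q\<close> by \<open>q * Z y\<close>.
\<close>

lemma chain_sum_sums:
  fixes Z :: "cletter \<Rightarrow> 'a::comm_ring_1 mfps"
  assumes "mcoeff q 0 = 0"
  shows "(\<lambda>t. q ^ t * chain_sum Z w (t, snd x, fst x)) mfps_sums
    tail_numerator Z q w x * (\<Prod>i = 1..length w + 1. inverse (1 - tail_prod Z q w i))"
  using assms
proof (induction w arbitrary: x q rule: rev_induct)
  case Nil
  \<comment> \<open>The chain sum of the empty word is 1 for every \<open>t\<close>; these are the
    partial sums of 1, 0, 0, ..., whence the single factor \<open>inverse (1 - q)\<close>.\<close>
  have "(\<lambda>t. q ^ t * (if t = 0 then 1 else 0)) mfps_sums 1"
    unfolding mfps_sums_iff[OF Nil] by (simp add: if_distrib sum.delta vanishes_upto_def cong: if_cong)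
  from mfps_sums_partial_sums[OF Nil this, of False] show ?case
    by (simp add: chain_sum_def tail_numerator_def descents_def tail_prod_def)
next
  case (snoc y w)
  obtain k c where y: "y = (k, c)" by force
  let ?D = "\<lambda>q w. \<Prod>i = 1..length w + 1. inverse (1 - tail_prod Z q w i)"
  let ?S = "tail_numerator Z (q * Z y) w y * ?D (q * Z y) w"
  \<comment> \<open>With the last letter at height \<open>t\<close>, its weight
    \<open>Z y ^ t\<close> merges with \<open>q ^ t\<close> into a power of
    \<open>q * Z y\<close>.\<close>
  have "(\<lambda>t. q ^ t * (chain_sum Z w (t, c, k) * Z y ^ t)) mfps_sums ?S"
    using snoc.IH[of "q * Z y" y] snoc.prems by (simp add: y power_mult_distrib mult_ac)
  from mfps_sums_partial_sums[OF snoc.prems this, of "color_less x y"]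
  have "(\<lambda>t. q ^ t * chain_sum Z (w @ [y]) (t, snd x, fst x)) mfps_sums
      (if color_less x y then q else 1) * ?S * inverse (1 - q)"
    by (simp only: chain_sum_snoc cells_below y prod.collapse)
  moreover have "?D q (w @ [y]) = ?D (q * Z y) w * inverse (1 - q)"
  proof -
    have "?D q (w @ [y]) = (\<Prod>i = 1..length w + 1. inverse (1 - tail_prod Z q (w @ [y]) i)) * inverse (1 - q)"
      using tail_prod_last[of Z q "w @ [y]"] by simp
    then show ?thesis by (simp add: tail_prod_snoc)
  qed
  ultimately show ?case by (simp only: tail_numerator_snoc mult.assoc)
qed

section \<open>Gaussian binomial coefficients count multisets\<close>

text \<open>Partitions in an \<open>M\<close> by \<open>N\<close> box; parts equal to 0 are allowed,
  so that there are exactly \<open>M\<close>.\<close>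

definition bounded_msets :: "nat \<Rightarrow> nat \<Rightarrow> nat multiset set" where
  "bounded_msets N M = {A. set_mset A \<subseteq> {..N} \<and> size A = M}"

lemma finite_bounded_msets: "finite (bounded_msets N M)"
proof -
  have "bounded_msets N M \<subseteq> mset ` {xs. set xs \<subseteq> {..N} \<and> length xs = M}"
  proof
    fix A assume "A \<in> bounded_msets N M"
    moreover obtain xs where "A = mset xs" using ex_mset by metis
    ultimately show "A \<in> mset ` {xs. set xs \<subseteq> {..N} \<and> length xs = M}"
      by (auto simp: bounded_msets_def)
  qed
  then show ?thesis by (rule finite_subset) (simp add: finite_lists_length_eq)
qed

lemma bounded_msets_0: "bounded_msets 0 M = {replicate_mset M 0}"
proof -
  have "A = replicate_mset (size A) 0" if "set_mset A \<subseteq> {0}" for A :: "nat multiset"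
    using that by (induction A) auto
  then show ?thesis by (auto simp: bounded_msets_def split: if_splits)
qed

text \<open>Either the largest permitted value occurs, and one copy is removed, or it does not: the
  Pascal recurrence for Gaussian binomials.\<close>

lemma bounded_msets_Suc:
  "bounded_msets (Suc N) (Suc M) =
    bounded_msets N (Suc M) \<union> add_mset (Suc N) ` bounded_msets (Suc N) M"
proof (intro equalityI subsetI)
  fix A assume A: "A \<in> bounded_msets (Suc N) (Suc M)"
  show "A \<in> bounded_msets N (Suc M) \<union> add_mset (Suc N) ` bounded_msets (Suc N) M"
  proof (cases "Suc N \<in># A")
    case True
    then obtain B where "A = add_mset (Suc N) B" by (metis insert_DiffM)
    then show ?thesis using A by (auto simp: bounded_msets_def)
  next
    case False
    then show ?thesis using A by (auto simp: bounded_msets_def) (metis atMost_iff le_Suc_eq subsetD)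
  qed
qed (auto simp: bounded_msets_def)

text \<open>By the Pascal recurrence, which lowers \<open>N + M\<close> by one in each term. Without
  division the identity makes sense in any commutative ring.\<close>

lemma bounded_msets_generating_function:
  fixes q :: "'a::comm_ring_1"
  shows "(\<Sum>A\<in>bounded_msets N M. q ^ sum_mset A) * (\<Prod>i = 1..M. 1 - q ^ i) = (\<Prod>i = 1..M. 1 - q ^ (N + i))"
proof (induction "N + M" arbitrary: N M)
  case 0
  then show ?case by (simp add: bounded_msets_0)
next
  case (Suc K)
  let ?h = "\<lambda>N M. \<Sum>A\<in>bounded_msets N M. q ^ sum_mset A"
  consider "N = 0" | "M = 0" | N' M' where "N = Suc N'" "M = Suc M'"
    by (cases N; cases M) auto
  then show ?case
  proof cases
    case 1
    then show ?thesis by (simp add: bounded_msets_0)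
  next
    case 2
    then have "bounded_msets N M = {{#}}" by (auto simp: bounded_msets_def)
    then show ?thesis using 2 by simp
  next
    case 3
    let ?P = "\<Prod>i = 1..M'. 1 - q ^ i" and ?Q = "\<Prod>i = 1..M'. 1 - q ^ (Suc N' + i)"
    have "?h N M = ?h N' (Suc M') + (\<Sum>A\<in>add_mset (Suc N') ` bounded_msets (Suc N') M'. q ^ sum_mset A)"
      unfolding 3 bounded_msets_Suc
      by (rule sum.union_disjoint) (auto simp: finite_bounded_msets, auto simp: bounded_msets_def)
    also have "(\<Sum>A\<in>add_mset (Suc N') ` bounded_msets (Suc N') M'. q ^ sum_mset A) = q ^ Suc N' * ?h (Suc N') M'"
      by (subst sum.reindex) (simp_all add: inj_on_def power_add sum_distrib_left mult_ac)
    finally have h: "?h N M = ?h N' (Suc M') + q ^ Suc N' * ?h (Suc N') M'" .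
    \<comment> \<open>Shifting the index isolates \<open>1 - q ^ Suc N'\<close>, so that both terms
      of the recurrence become multiples of \<open>?Q\<close>.\<close>
    have 1: "?h N' (Suc M') * (\<Prod>i = 1..Suc M'. 1 - q ^ i) = (1 - q ^ Suc N') * ?Q"
    proof -
      have "?h N' (Suc M') * (\<Prod>i = 1..Suc M'. 1 - q ^ i) = (\<Prod>i = 1..Suc M'. 1 - q ^ (N' + i))"
        using Suc.hyps(2) 3 by (intro Suc.hyps(1)) simp
      also have "\<dots> = (\<Prod>i = 0..M'. 1 - q ^ (Suc N' + i))"
        using prod.shift_bounds_cl_Suc_ivl[of "\<lambda>i. 1 - q ^ (N' + i)" 0 M'] by simp
      also have "\<dots> = (1 - q ^ Suc N') * ?Q"
        by (subst prod.atLeast_Suc_atMost) simp_all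
      finally show ?thesis .
    qed
    have 2: "?h (Suc N') M' * ?P = ?Q"
      using Suc.hyps(2) 3 by (intro Suc.hyps(1)) simp
    have "?h N M * (\<Prod>i = 1..M. 1 - q ^ i) =
      ?h N' (Suc M') * (\<Prod>i = 1..Suc M'. 1 - q ^ i) + q ^ Suc N' * (?h (Suc N') M' * ?P) * (1 - q ^ Suc M')"
      unfolding h using 3 by (simp add: algebra_simps)
    also have "\<dots> = ?Q * (1 - q ^ (Suc N' + Suc M'))"
      unfolding 1 2 by (simp add: algebra_simps power_add)
    finally show ?thesis using 3 by simp
  qed
qed

text \<open>As \<open>q\<close> has no constant term, each \<open>1 - q ^ i\<close> with
  \<open>i \<ge> 1\<close> is invertible and the denominators can be cleared.\<close>

lemma qbinom_eq_sum:
  fixes q :: "'a::comm_ring_1 mfps"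
  assumes "mcoeff q 0 = 0"
  shows "qbinom (N + M) M q = (\<Sum>A\<in>bounded_msets N M. q ^ sum_mset A)"
proof -
  have one: "mcoeff (1 - q ^ i) 0 = 1" if "i \<in> {1..M}" for i
    using that assms by (simp add: mcoeff_power_0 power_0_left)
  have "inverse (\<Prod>i = 1..M. 1 - q ^ i) = (\<Prod>i = 1..M. inverse (1 - q ^ i))"
    using one by (rule inverse_mfps_prod)
  then have "qbinom (N + M) M q = (\<Prod>i = 1..M. 1 - q ^ (N + i)) / (\<Prod>i = 1..M. 1 - q ^ i)"
    by (simp add: qbinom_def divide_mfps_def prod.distrib)
  also have "\<dots> = (\<Sum>A\<in>bounded_msets N M. q ^ sum_mset A)"
  proof (rule mfps_divide_eqI)
    show "mcoeff (\<Prod>i = 1..M. 1 - q ^ i) 0 = 1"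
      unfolding mcoeff_prod_0 using one by (intro prod.neutral) blast
  qed (rule bounded_msets_generating_function)
  finally show ?thesis .
qed

section \<open>Sorted lists of cells and tuples of multisets\<close>

lemma prod_list_map_eq_prod: "prod_list (map f w) = (\<Prod>j = 1..length w. f (w ! (j - 1)))"
proof (induction w rule: rev_induct)
  case (snoc y w)
  have "(\<Prod>j = 1..length w. f ((w @ [y]) ! (j - 1))) = (\<Prod>j = 1..length w. f (w ! (j - 1)))"
    by (intro prod.cong) (auto simp: nth_append)
  then show ?case using snoc by simp
qed simp

lemma size_filter_mset_eq_count: "size {#x \<in># M. f x = y#} = count (image_mset f M) y"
  by (induction M) auto

lemma filter_mset_sum: "filter_mset P (\<Sum>x\<in>A. f x) = (\<Sum>x\<in>A. filter_mset P (f x))"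
  by (induction A rule: infinite_finite_induct) auto

lemma mset_eq_sum_filter:
  assumes "finite K" "f ` set_mset M \<subseteq> K"
  shows "M = (\<Sum>k\<in>K. {#x \<in># M. f x = k#})"
proof (rule multiset_eqI)
  fix x
  show "count M x = count (\<Sum>k\<in>K. {#x \<in># M. f x = k#}) x"
  proof (cases "x \<in># M")
    case True
    then have "f x \<in> K" using assms(2) by blast
    then show ?thesis using assms(1) by (simp add: count_sum)
  qed (simp add: count_sum not_in_iff cong: if_cong)
qed

lemma prod_mset_sum_mset: "(\<Prod>x\<in>#(\<Sum>k\<in>K. f k). g x) = (\<Prod>k\<in>K. \<Prod>x\<in>#f k. g x)"
  by (induction K rule: infinite_finite_induct) auto

lemma prod_mset_power: "(\<Prod>x\<in>#A. q ^ f x) = q ^ (\<Sum>x\<in>#A. f x)"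
  by (induction A) (auto simp: power_add)

section \<open>Cells as numbers, by division with remainder\<close>

definition kind :: "cell \<Rightarrow> nat" where
  "kind = (\<lambda>(s, c, k). k)"

text \<open>The exponent that a cell contributes to the variable of its letter: \<open>r k\<close>
  per unit of height and \<open>c - 1\<close> from the color. For colors in \<open>{1..r k}\<close>,
  height and \<open>c - 1\<close> are its quotient and remainder modulo \<open>r k\<close>.\<close>

definition rank :: "(nat \<Rightarrow> nat) \<Rightarrow> cell \<Rightarrow> nat" where
  "rank r = (\<lambda>(s, c, k). r k * s + (c - 1))"

definition cell_at :: "(nat \<Rightarrow> nat) \<Rightarrow> nat \<Rightarrow> nat \<Rightarrow> cell" where
  "cell_at r k a = (a div r k, a mod r k + 1, k)"

text \<open>The bound admits all colors below height \<open>t\<close> but only color 1 at height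
  \<open>t\<close>; if \<open>r k \<ge> 1\<close>, the ranks for a letter \<open>k\<close> in
  \<open>{1..n}\<close> thus fill exactly \<open>{0..r k * t}\<close>.\<close>

definition cells :: "nat \<Rightarrow> (nat \<Rightarrow> nat) \<Rightarrow> nat \<Rightarrow> cell set" where
  "cells n r t = {x. kind x \<in> {1..n} \<and> snd (letter_of x) \<in> {1..r (kind x)} \<and> x \<le> (t, 1, n + 1)}"

lemma kind_cell_at [simp]: "kind (cell_at r k a) = k"
  by (simp add: kind_def cell_at_def)

lemma rank_cell_at [simp]: "rank r (cell_at r k a) = a"
  by (simp add: rank_def cell_at_def)

lemma cell_at_rank:
  assumes "x \<in> cells n r t"
  shows "cell_at r (kind x) (rank r x) = x"
proof -
  obtain s c k where x: "x = (s, c, k)" by (cases x)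
  obtain d where "c = Suc d" "d < r k"
    using assms by (cases c) (auto simp: x cells_def letter_of_def kind_def)
  then show ?thesis by (simp add: x cell_at_def kind_def rank_def)
qed

lemma rank_le:
  assumes "x \<in> cells n r t"
  shows "rank r x \<le> r (kind x) * t"
proof -
  obtain s c k where x: "x = (s, c, k)" by (cases x)
  have c: "1 \<le> c" "c \<le> r k" and le: "(s, c, k) \<le> (t, 1, n + 1)"
    using assms by (auto simp: x cells_def letter_of_def kind_def)
  show ?thesis
  proof (cases "s < t")
    case True
    have "r k * s + (c - 1) \<le> r k * Suc s" using c by simp
    also have "\<dots> \<le> r k * t" using True by (intro mult_le_mono2) simp
    finally show ?thesis by (simp add: x kind_def rank_def)
  next
    case False
    then show ?thesis using le c by (auto simp: x kind_def rank_def)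
  qed
qed

lemma cell_at_in_cells:
  assumes "k \<in> {1..n}" "1 \<le> r k" "a \<le> r k * t"
  shows "cell_at r k a \<in> cells n r t"
proof -
  have "a div r k \<le> t" using assms(2,3) by (metis div_le_mono nonzero_mult_div_cancel_left not_one_le_zero)
  \<comment> \<open>Quotient \<open>t\<close> leaves no room for a positive remainder, so the color
    is 1 there.\<close>
  moreover have "a mod r k = 0" if "a div r k = t"
  proof -
    have "r k * t + a mod r k = a" using that by (metis mult_div_mod_eq)
    then show ?thesis using assms(3) by simp
  qed
  ultimately have "a div r k < t \<or> a div r k \<le> t \<and> a mod r k = 0"
    by linarith
  moreover have "Suc (a mod r k) \<le> r k" using assms(2) by (simp add: Suc_le_eq)
  ultimately show ?thesis using assms(1)
    by (auto simp: cells_def cell_at_def kind_def letter_of_def)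
qed

definition cell_lists :: "nat \<Rightarrow> (nat \<Rightarrow> nat) \<Rightarrow> (nat \<Rightarrow> nat) \<Rightarrow> nat \<Rightarrow> cell list set" where
  "cell_lists n \<mu> r t =
    {L. sorted L \<and> set L \<subseteq> cells n r t \<and> (\<forall>k\<in>{1..n}. count (image_mset kind (mset L)) k = \<mu> k)}"

definition cell_msets :: "nat \<Rightarrow> (nat \<Rightarrow> nat) \<Rightarrow> (nat \<Rightarrow> nat) \<Rightarrow> nat \<Rightarrow> cell multiset set" where
  "cell_msets n \<mu> r t =
    {M. set_mset M \<subseteq> cells n r t \<and> (\<forall>k\<in>{1..n}. count (image_mset kind M) k = \<mu> k)}"

text \<open>The word of a list is read off by \<open>map letter_of\<close>, and the bound in
  \<open>cells\<close> accounts for the appended letter at height \<open>t\<close>.\<close>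

lemma cell_lists_eq: "cell_lists n \<mu> r t = (\<Union>w\<in>colored_perms n \<mu> r. cell_chains w (t, 1, n + 1))"
proof -
  have "L \<in> cell_lists n \<mu> r t \<longleftrightarrow>
      map letter_of L \<in> colored_perms n \<mu> r \<and> L \<in> cell_chains (map letter_of L) (t, 1, n + 1)" for L
  proof -
    have fst: "fst (letter_of x) = kind x" for x
      by (simp add: letter_of_def kind_def case_prod_beta)
    then have map: "map fst (map letter_of L) = map kind L"
      by simp
    have "count_list (map kind L) k = count (image_mset kind (mset L)) k" for k
      by (simp flip: mset_map add: count_mset)
    then show ?thesis
      unfolding cell_lists_def colored_perms_def cell_chains_def mem_Collect_eq map sorted_append
      by (auto simp: cells_def fst case_prod_beta simp del: less_eq_prod_simp)
  qed
  then show ?thesis by (auto simp: cell_chains_def)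
qed

lemma sum_cell_lists:
  "(\<Sum>w\<in>colored_perms n \<mu> r. sum h (cell_chains w (t, 1, n + 1))) = sum h (cell_lists n \<mu> r t)"
  unfolding cell_lists_eq
  by (rule sum.UNION_disjoint[symmetric])
    (simp_all add: finite_colored_perms finite_cell_chains, auto simp: cell_chains_def)

lemma sum_cell_lists_mset:
  "(\<Sum>L\<in>cell_lists n \<mu> r t. g (mset L)) = sum g (cell_msets n \<mu> r t)"
  by (rule sum.reindex_bij_witness[of _ sorted_list_of_multiset mset])
    (auto simp: cell_lists_def cell_msets_def sorted_sort_id)

text \<open>A multiset of cells splits by letter into independent parts, and \<open>rank\<close>
  identifies the part of letter \<open>k\<close> with a multiset of \<open>\<mu> k\<close> numbers
  up to \<open>r k * t\<close>. The product of sums is the sum over choice functions.\<close>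

lemma sum_cell_msets:
  fixes z :: "nat \<Rightarrow> 'a::comm_semiring_1"
  assumes "\<And>k. k \<in> {1..n} \<Longrightarrow> 1 \<le> r k"
  shows "(\<Sum>M\<in>cell_msets n \<mu> r t. \<Prod>x\<in>#M. z (kind x) ^ rank r x) =
    (\<Prod>k = 1..n. \<Sum>A\<in>bounded_msets (r k * t) (\<mu> k). z k ^ sum_mset A)"
proof -
  \<comment> \<open>\<open>?F\<close> and \<open>?G\<close> are mutually inverse between
    \<open>cell_msets\<close> and \<open>?P\<close>; the restricted lambda makes \<open>?F M\<close>
    extensional, as \<open>?P\<close> requires.\<close>
  let ?F = "\<lambda>M. \<lambda>k\<in>{1..n}. image_mset (rank r) {#x \<in># M. kind x = k#}"
  let ?G = "\<lambda>f. \<Sum>k = 1..n. image_mset (cell_at r k) (f k)"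
  let ?P = "Pi\<^sub>E {1..n} (\<lambda>k. bounded_msets (r k * t) (\<mu> k))"
  have decomp: "M = (\<Sum>k = 1..n. {#x \<in># M. kind x = k#})" if "M \<in> cell_msets n \<mu> r t" for M
    using that by (intro mset_eq_sum_filter) (auto simp: cell_msets_def cells_def)
  have filter: "{#x \<in># ?G f. kind x = k#} = image_mset (cell_at r k) (f k)" if "k \<in> {1..n}" for f k
  proof -
    have "{#x \<in># ?G f. kind x = k#} = (\<Sum>l = 1..n. if l = k then image_mset (cell_at r k) (f k) else {#})"
      unfolding filter_mset_sum by (intro sum.cong) (auto simp: filter_mset_image_mset)
    then show ?thesis using that by simp
  qed
  \<comment> \<open>Simplification writes the lower bound 1 as \<open>Suc 0\<close>; this copy
    matches that form.\<close>
  note filter' = filter[unfolded One_nat_def]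
  have "(\<Sum>M\<in>cell_msets n \<mu> r t. \<Prod>x\<in>#M. z (kind x) ^ rank r x) =
      (\<Sum>f\<in>?P. \<Prod>k = 1..n. z k ^ sum_mset (f k))"
  proof (rule sum.reindex_bij_witness[of _ ?G ?F])
    fix M assume M: "M \<in> cell_msets n \<mu> r t"
    have "?G (?F M) = (\<Sum>k = 1..n. {#x \<in># M. kind x = k#})"
    proof (rule sum.cong)
      fix k assume k: "k \<in> {1..n}"
      have "image_mset (\<lambda>x. cell_at r k (rank r x)) {#x \<in># M. kind x = k#} =
          image_mset (\<lambda>x. x) {#x \<in># M. kind x = k#}"
        using M by (intro image_mset_cong) (auto simp: cell_msets_def cell_at_rank)
      then show "image_mset (cell_at r k) (?F M k) = {#x \<in># M. kind x = k#}"
        using k by (simp add: multiset.map_comp comp_def)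
    qed simp
    then show "?G (?F M) = M" using decomp[OF M] by simp
    show "?F M \<in> ?P"
      using M rank_le
      by (fastforce simp: bounded_msets_def cell_msets_def size_filter_mset_eq_count)
    have "(\<Prod>x\<in>#M. z (kind x) ^ rank r x) = (\<Prod>k = 1..n. \<Prod>x\<in>#{#x \<in># M. kind x = k#}. z (kind x) ^ rank r x)"
      using arg_cong[OF decomp[OF M], of "\<lambda>M. \<Prod>x\<in>#M. z (kind x) ^ rank r x"]
      by (simp only: prod_mset_sum_mset)
    also have "\<dots> = (\<Prod>k = 1..n. z k ^ sum_mset (?F M k))"
    proof (rule prod.cong)
      fix k assume k: "k \<in> {1..n}"
      have "(\<Prod>x\<in>#{#x \<in># M. kind x = k#}. z (kind x) ^ rank r x) = (\<Prod>x\<in>#{#x \<in># M. kind x = k#}. z k ^ rank r x)"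
        by (intro arg_cong[where f = prod_mset] image_mset_cong) auto
      then show "(\<Prod>x\<in>#{#x \<in># M. kind x = k#}. z (kind x) ^ rank r x) = z k ^ sum_mset (?F M k)"
        using k by (simp add: prod_mset_power)
    qed simp
    finally show "(\<Prod>k = 1..n. z k ^ sum_mset (?F M k)) = (\<Prod>x\<in>#M. z (kind x) ^ rank r x)" ..
  next
    fix f assume f: "f \<in> ?P"
    show "?F (?G f) = f"
    proof (rule PiE_ext[OF _ f])
      show "?F (?G f) k = f k" if "k \<in> {1..n}" for k
        using that by (simp add: filter' multiset.map_comp comp_def)
      show "?F (?G f) \<in> Pi\<^sub>E {1..n} (\<lambda>k. bounded_msets (r k * t) (\<mu> k))"
        using f by (auto simp: filter' multiset.map_comp comp_def PiE_def)
    qed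
    have "a \<le> r k * t" if "k \<in> {1..n}" "a \<in># f k" for k a
      using f that by (auto simp: bounded_msets_def dest!: PiE_mem)
    then have "set_mset (?G f) \<subseteq> cells n r t"
      by (auto simp: set_mset_sum simp del: split_paired_All intro!: cell_at_in_cells assms)
    moreover have "count (image_mset kind (?G f)) k = \<mu> k" if "k \<in> {1..n}" for k
      using f that by (auto simp: size_filter_mset_eq_count[symmetric] filter' bounded_msets_def)
    ultimately show "?G f \<in> cell_msets n \<mu> r t"
      by (simp add: cell_msets_def)
  qed
  also have "\<dots> = (\<Prod>k = 1..n. \<Sum>A\<in>bounded_msets (r k * t) (\<mu> k). z k ^ sum_mset A)"
    by (rule prod_sum_PiE[symmetric]) (simp_all add: finite_bounded_msets)
  finally show ?thesis .
qed

text \<open>The color factor \<open>z k ^ (c - 1)\<close> and the height factor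
  \<open>(z k ^ r k) ^ s\<close> combine to the power of \<open>z k\<close> given by the rank. This
  weight depends only on the multiset of cells, so the sum factors by letter.\<close>

lemma sum_colored_perms_chain_sum:
  fixes z :: "nat \<Rightarrow> 'a::comm_semiring_1"
  assumes "\<And>k. k \<in> {1..n} \<Longrightarrow> 1 \<le> r k"
  shows "(\<Sum>w\<in>colored_perms n \<mu> r.
      (\<Prod>x\<leftarrow>w. z (fst x) ^ (snd x - 1)) * chain_sum (\<lambda>x. z (fst x) ^ r (fst x)) w (t, 1, n + 1)) =
    (\<Prod>k = 1..n. \<Sum>A\<in>bounded_msets (r k * t) (\<mu> k). z k ^ sum_mset A)"
proof -
  have "(\<Prod>x\<leftarrow>w. z (fst x) ^ (snd x - 1)) * (\<Prod>x\<leftarrow>L. (z (fst (letter_of x)) ^ r (fst (letter_of x))) ^ fst x)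
      = (\<Prod>x\<in>#mset L. z (kind x) ^ rank r x)" if "L \<in> cell_chains w e" for w L e
  proof -
    have w: "w = map letter_of L" using that by (simp add: cell_chains_def)
    show ?thesis unfolding w
      by (induction L) (auto simp: letter_of_def kind_def rank_def power_add mult_ac simp flip: power_mult)
  qed
  then have "(\<Sum>w\<in>colored_perms n \<mu> r.
      (\<Prod>x\<leftarrow>w. z (fst x) ^ (snd x - 1)) * chain_sum (\<lambda>x. z (fst x) ^ r (fst x)) w (t, 1, n + 1)) =
    (\<Sum>w\<in>colored_perms n \<mu> r. \<Sum>L\<in>cell_chains w (t, 1, n + 1). \<Prod>x\<in>#mset L. z (kind x) ^ rank r x)"
    unfolding chain_sum_def sum_distrib_left by (intro sum.cong refl)
  also have "\<dots> = (\<Sum>M\<in>cell_msets n \<mu> r t. \<Prod>x\<in>#M. z (kind x) ^ rank r x)"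
    unfolding sum_cell_lists by (rule sum_cell_lists_mset)
  also have "\<dots> = (\<Prod>k = 1..n. \<Sum>A\<in>bounded_msets (r k * t) (\<mu> k). z k ^ sum_mset A)"
    using assms by (rule sum_cell_msets)
  finally show ?thesis .
qed

lemma length_colored_perms:
  assumes "w \<in> colored_perms n \<mu> r"
  shows "length w = (\<Sum>k = 1..n. \<mu> k)"
proof -
  have "length w = (\<Sum>k = 1..n. count_list (map fst w) k)"
    using sum_count_set[of "map fst w" "{1..n}"] assms by (simp add: colored_perms_def)
  also have "\<dots> = (\<Sum>k = 1..n. \<mu> k)"
    using assms by (intro sum.cong) (auto simp: colored_perms_def)
  finally show ?thesis .
qed

theorem theorem1:
  fixes n m :: nat and mult r :: "nat \<Rightarrow> nat"
  assumes "n \<ge> 1"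
    and "\<forall>k\<in>{1..n}. mult k \<ge> 1"
    and "\<forall>k\<in>{1..n}. r k \<ge> 1"
    and "m = (\<Sum>k = 1..n. mult k)"
  shows "(\<lambda>t. mvar (m + 1) ^ t * (\<Prod>k = 1..n. qbinom (r k * t + mult k) (mult k) (mvar k)))
    mfps_sums
      (\<Sum>w\<in>colored_perms n mult r.
         ((\<Prod>j = 1..m. mvar (letter_at w j) ^ (color_at w j - 1)) *
          (\<Prod>i\<in>{i \<in> {2..m + 1}. i - 1 \<in> DES n w}. tail_monom r w i)) /
         (\<Prod>i = 1..m + 1. 1 - tail_monom r w i) :: 'a::comm_ring_1 mfps)"
proof -
  let ?z = "mvar :: nat \<Rightarrow> 'a mfps"
  let ?q = "?z (m + 1)"
  let ?Z = "\<lambda>x. ?z (fst x) ^ r (fst x)"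
  let ?c = "\<lambda>w. \<Prod>x\<leftarrow>w. ?z (fst x) ^ (snd x - 1)"
  let ?S = "\<lambda>w. tail_numerator ?Z ?q w (n + 1, 1) * (\<Prod>i = 1..length w + 1. inverse (1 - tail_prod ?Z ?q w i))"
  have q0: "mcoeff ?q 0 = 0" by simp
  have "(\<lambda>t. ?q ^ t * (\<Sum>w\<in>colored_perms n mult r. ?c w * chain_sum ?Z w (t, 1, n + 1)))
      mfps_sums (\<Sum>w\<in>colored_perms n mult r. ?c w * ?S w)"
    using chain_sum_sums[OF q0, of ?Z _ "(n + 1, 1)"] by (intro mfps_sums_sum[OF q0]) simp
  moreover have "(\<Sum>w\<in>colored_perms n mult r. ?c w * chain_sum ?Z w (t, 1, n + 1)) =
      (\<Prod>k = 1..n. qbinom (r k * t + mult k) (mult k) (?z k))" for t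
  proof -
    have "(\<Prod>k = 1..n. qbinom (r k * t + mult k) (mult k) (?z k)) =
        (\<Prod>k = 1..n. \<Sum>A\<in>bounded_msets (r k * t) (mult k). ?z k ^ sum_mset A)"
      by (intro prod.cong qbinom_eq_sum) simp_all
    then show ?thesis using sum_colored_perms_chain_sum[where z = ?z and \<mu> = mult and t = t] assms(3) by simp
  qed
  moreover have "?c w * ?S w =
      ((\<Prod>j = 1..m. ?z (letter_at w j) ^ (color_at w j - 1)) *
        (\<Prod>i\<in>{i \<in> {2..m + 1}. i - 1 \<in> DES n w}. tail_monom r w i)) /
       (\<Prod>i = 1..m + 1. 1 - tail_monom r w i)" if "w \<in> colored_perms n mult r" for w
  proof -
    \<comment> \<open>All words have length \<open>m\<close>, so the variable of
      \<open>tail_monom\<close> indexed by the length is \<open>?q\<close>.\<close>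
    have len: "length w = m" using length_colored_perms[OF that] assms(4) by simp
    have tail: "tail_monom r w = tail_prod ?Z ?q w"
      by (simp add: fun_eq_iff tail_monom_def tail_prod_def letter_at_def len)
    have des: "DES n w = descents w (n + 1, 1)"
      by (simp add: DES_def descents_def)
    \<comment> \<open>Each tail product contains the factor \<open>?q\<close>, so every factor of
      the denominator is invertible.\<close>
    have "mcoeff (1 - tail_prod ?Z ?q w i) 0 = 1" for i
      by (simp add: tail_prod_def)
    then have "inverse (\<Prod>i = 1..m + 1. 1 - tail_prod ?Z ?q w i) =
        (\<Prod>i = 1..m + 1. inverse (1 - tail_prod ?Z ?q w i))"
      by (intro inverse_mfps_prod)
    moreover have "?c w = (\<Prod>j = 1..m. ?z (letter_at w j) ^ (color_at w j - 1))"
      by (simp only: prod_list_map_eq_prod letter_at_def color_at_def len)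
    ultimately show ?thesis
      by (simp only: tail des tail_numerator_def divide_mfps_def len mult.assoc)
  qed
  ultimately show ?thesis by simp
qed

end
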